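(* Let $\Sigma_1,\Sigma_2$ be compact Riemann surfaces, possibly with boundary, and let $f:(\Sigma_1,\partial\Sigma_1)\to(\Sigma_2,\partial\Sigma_2)$ be a diffeomorphism which is bi-holomorphic. Let $D_1\subset\Sigma_1$ be a finite subset which does not meet $\partial\Sigma_1$ and $D_2=f(D_1)$. Let $\omega\in\mathcal A^2(\Sigma_2,\star D_2)$. Then the pull-back $f^*\omega$ lies in $\mathcal A^2(\Sigma_1,\star D_1)$ and $$\operatorname{Reg}\!\int_{\Sigma_1}f^*\omega=\operatorname{Reg}\!\int_{\Sigma_2}\omega.$$
   Context: Let $\Sigma$ be a compact Riemann surface, possibly with boundary $\partial\Sigma$, and $D\subset\Sigma$ a finite subset not meeting $\partial\Sigma$. $\mathcal A^{p,q}(\Sigma,\star D)$ is the space of complex-valued $(p,q)$-forms which are smooth on $\Sigma\setminus D$ and which near each $p\in D$ have the form $\alpha_0/z^N$, where $z$ is a local holomorphic coordinate with $z(p)=0$, $N\ge0$ is an integer and $\alpha_0$ is a smooth form near $p$. $\mathcal A^2(\Sigma,\star D)=\mathcal A^{1,1}(\Sigma,\star D)$. $\mathcal A^2(\Sigma,\log D)$ is the subspace of forms which near each $p\in D$ have the form $\frac{dz}z\wedge\beta_0$ with $\beta_0$ a smooth $(0,1)$-form. $\partial$ is the holomorphic de Rham differential. Every $\omega\in\mathcal A^2(\Sigma,\star D)$ can be written $\omega=\alpha+\partial\beta$ with $\alpha\in\mathcal A^2(\Sigma,\log D)$, $\beta\in\mathcal A^{0,1}(\Sigma,\star D)$, and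 the regularized integral is $\operatorname{Reg}\!\int_\Sigma\omega:=\int_\Sigma\alpha+\int_{\partial\Sigma}\beta$, which is well defined and independent of the choice of $\alpha,\beta$. *)

theory Defs
  imports "HOL-Analysis.Analysis"
begin

section \<open>Smooth and holomorphic functions on relatively open subsets of the half plane\<close>

definition half_plane :: "complex set"
  where "half_plane = {z. 0 \<le> Im z}"

primrec Ck_on :: "nat \<Rightarrow> (complex \<Rightarrow> 'b::real_normed_vector) \<Rightarrow> complex set \<Rightarrow> bool"
  where
    "Ck_on 0 f W \<longleftrightarrow> continuous_on W f"
  | "Ck_on (Suc k) f W \<longleftrightarrow>
       (\<forall>z\<in>W. f differentiable (at z)) \<and>
       (\<forall>v. Ck_on k (\<lambda>z. frechet_derivative f (at z) v) W)"

definition Cinf_on :: "(complex \<Rightarrow> 'b::real_normed_vector) \<Rightarrow> complex set \<Rightarrow> bool"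
  where "Cinf_on f W \<longleftrightarrow> (\<forall>k. Ck_on k f W)"

text \<open>For sets \<open>S\<close> that are only relatively open in the half plane (smoothness up to the
  boundary): \<open>f\<close> extends locally to a smooth function on an open subset of the plane.\<close>

definition smooth_on :: "(complex \<Rightarrow> 'b::real_normed_vector) \<Rightarrow> complex set \<Rightarrow> bool"
  where "smooth_on f S \<longleftrightarrow>
    (\<forall>z\<in>S. \<exists>W g. open W \<and> z \<in> W \<and> Cinf_on g W \<and> (\<forall>w\<in>W \<inter> S. g w = f w))"

text \<open>The two derivatives below are taken within \<open>S\<close> so that they also make sense at boundary
  points. On a relatively open subset of the half plane they are uniquely determined.\<close>

definition cderiv_within :: "(complex \<Rightarrow> complex) \<Rightarrow> complex set \<Rightarrow> complex \<Rightarrow> complex"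
  where "cderiv_within h S z = (THE d. (h has_field_derivative d) (at z within S))"

text \<open>The operator \<open>\<partial>/\<partial>z = (\<partial>/\<partial>x - \<i> \<partial>/\<partial>y) / 2\<close>.\<close>

definition dz_within :: "(complex \<Rightarrow> complex) \<Rightarrow> complex set \<Rightarrow> complex \<Rightarrow> complex"
  where "dz_within g S z =
    (let g' = frechet_derivative g (at z within S) in (g' 1 - \<i> * g' \<i>) / 2)"


section \<open>Compact Riemann surfaces with boundary\<close>

text \<open>A chart is a pair of its domain and its coordinate function; the values of the latter
  outside the domain are irrelevant.\<close>

type_synonym 'a chart = "'a set \<times> ('a \<Rightarrow> complex)"

definition chart_inv :: "'a chart \<Rightarrow> complex \<Rightarrow> 'a"
  where "chart_inv c = inv_into (fst c) (snd c)"

definition is_chart :: "'a topology \<Rightarrow> 'a chart \<Rightarrow> bool"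
  where "is_chart X c \<longleftrightarrow>
    openin X (fst c) \<and>
    openin (top_of_set half_plane) (snd c ` fst c) \<and>
    homeomorphic_map (subtopology X (fst c)) (top_of_set (snd c ` fst c)) (snd c)"

definition overlap :: "'a chart \<Rightarrow> 'a chart \<Rightarrow> complex set"
  where "overlap c c' = snd c ` (fst c \<inter> fst c')"

definition transition :: "'a chart \<Rightarrow> 'a chart \<Rightarrow> complex \<Rightarrow> complex"
  where "transition c c' = snd c' \<circ> chart_inv c"

text \<open>On sets meeting the real line, \<open>holomorphic_on\<close> asks for complex differentiability within
  the half plane. Transition maps send boundary points to real numbers, so by Schwarz reflection
  this is the same as being the restriction of a holomorphic function on an open set.\<close>

definition compatible :: "'a chart \<Rightarrow> 'a chart \<Rightarrow> bool"
  where "compatible c c' \<longleftrightarrow>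
    transition c c' holomorphic_on overlap c c' \<and>
    transition c' c holomorphic_on overlap c' c"

record 'a surface =
  surf_top :: "'a topology"
  charts :: "'a chart set"

abbreviation points :: "'a surface \<Rightarrow> 'a set"
  where "points S \<equiv> topspace (surf_top S)"

text \<open>The complex structure is given as a maximal atlas. Connectedness is not required, and
  second countability follows from compactness.\<close>

definition compact_riemann_surface :: "'a surface \<Rightarrow> bool"
  where "compact_riemann_surface S \<longleftrightarrow>
    compact_space (surf_top S) \<and> Hausdorff_space (surf_top S) \<and>
    (\<forall>c\<in>charts S. is_chart (surf_top S) c) \<and>
    (\<Union>c\<in>charts S. fst c) = points S \<and>
    (\<forall>c\<in>charts S. \<forall>c'\<in>charts S. compatible c c') \<and>
    (\<forall>c. is_chart (surf_top S) c \<and> (\<forall>c'\<in>charts S. compatible c c') \<longrightarrow> c \<in> charts S)"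

definition boundary :: "'a surface \<Rightarrow> 'a set"
  where "boundary S = {p. \<exists>c\<in>charts S. p \<in> fst c \<and> Im (snd c p) = 0}"


section \<open>Maps between surfaces\<close>

definition local_expr :: "('a \<Rightarrow> 'b) \<Rightarrow> 'a chart \<Rightarrow> 'b chart \<Rightarrow> complex \<Rightarrow> complex"
  where "local_expr f c c' = snd c' \<circ> f \<circ> chart_inv c"

definition local_dom :: "('a \<Rightarrow> 'b) \<Rightarrow> 'a chart \<Rightarrow> 'b chart \<Rightarrow> complex set"
  where "local_dom f c c' = snd c ` (fst c \<inter> f -` fst c')"

definition smooth_map :: "'a surface \<Rightarrow> 'b surface \<Rightarrow> ('a \<Rightarrow> 'b) \<Rightarrow> bool"
  where "smooth_map S T f \<longleftrightarrow> continuous_map (surf_top S) (surf_top T) f \<and>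
    (\<forall>c\<in>charts S. \<forall>c'\<in>charts T. smooth_on (local_expr f c c') (local_dom f c c'))"

definition holomorphic_map :: "'a surface \<Rightarrow> 'b surface \<Rightarrow> ('a \<Rightarrow> 'b) \<Rightarrow> bool"
  where "holomorphic_map S T f \<longleftrightarrow> continuous_map (surf_top S) (surf_top T) f \<and>
    (\<forall>c\<in>charts S. \<forall>c'\<in>charts T. local_expr f c c' holomorphic_on local_dom f c c')"

definition diffeomorphism :: "'a surface \<Rightarrow> 'b surface \<Rightarrow> ('a \<Rightarrow> 'b) \<Rightarrow> bool"
  where "diffeomorphism S T f \<longleftrightarrow> bij_betw f (points S) (points T) \<and>
    smooth_map S T f \<and> smooth_map T S (inv_into (points S) f)"

definition biholomorphic :: "'a surface \<Rightarrow> 'b surface \<Rightarrow> ('a \<Rightarrow> 'b) \<Rightarrow> bool"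
  where "biholomorphic S T f \<longleftrightarrow> bij_betw f (points S) (points T) \<and>
    holomorphic_map S T f \<and> holomorphic_map T S (inv_into (points S) f)"


section \<open>Differential forms with poles\<close>

text \<open>A \<open>(p,q)\<close>-form (\<open>p, q \<le> 1\<close>) is given by its coefficients with respect to all charts:
  \<open>\<omega> c x\<close> is the coefficient at the point \<open>x\<close> with respect to \<open>1\<close>, \<open>dz\<close>, \<open>d(cnj z)\<close> or
  \<open>dz \<and> d(cnj z)\<close>, where \<open>z = snd c\<close>. Values for \<open>x\<close> outside the domain of \<open>c\<close> or in the polar set,
  and for \<open>c\<close> outside the atlas, are irrelevant.\<close>

type_synonym 'a form = "'a chart \<Rightarrow> 'a \<Rightarrow> complex"

definition in_coord :: "'a form \<Rightarrow> 'a chart \<Rightarrow> complex \<Rightarrow> complex"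
  where "in_coord \<omega> c = \<omega> c \<circ> chart_inv c"

definition is_form :: "nat \<Rightarrow> nat \<Rightarrow> 'a surface \<Rightarrow> 'a set \<Rightarrow> 'a form \<Rightarrow> bool"
  where "is_form p q S D \<omega> \<longleftrightarrow>
    (\<forall>c\<in>charts S. \<forall>c'\<in>charts S. \<forall>x \<in> (fst c \<inter> fst c') - D.
       let t' = cderiv_within (transition c c') (overlap c c') (snd c x)
       in \<omega> c x = \<omega> c' x * t' ^ p * cnj t' ^ q) \<and>
    (\<forall>c\<in>charts S. smooth_on (in_coord \<omega> c) (snd c ` (fst c - D)))"

text \<open>Near \<open>x\<close> the form is \<open>\<alpha>\<^sub>0 / z ^ N\<close> with \<open>\<alpha>\<^sub>0\<close> smooth and \<open>z\<close> the local coordinate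
  \<open>snd c - snd c x\<close>. The subtraction is needed because charts take values in the closed half
  plane, so that interior points never have coordinate \<open>0\<close>.\<close>

definition pole_at :: "'a set \<Rightarrow> nat \<Rightarrow> 'a surface \<Rightarrow> 'a form \<Rightarrow> 'a \<Rightarrow> bool"
  where "pole_at D N S \<omega> x \<longleftrightarrow>
    (\<exists>c\<in>charts S. x \<in> fst c \<and>
      (\<exists>W g. open W \<and> snd c x \<in> W \<and> Cinf_on g W \<and>
        (\<forall>y \<in> fst c - D. snd c y \<in> W \<longrightarrow> \<omega> c y = g (snd c y) / (snd c y - snd c x) ^ N)))"

definition forms_star :: "nat \<Rightarrow> nat \<Rightarrow> 'a surface \<Rightarrow> 'a set \<Rightarrow> 'a form set"
  where "forms_star p q S D = {\<omega>. is_form p q S D \<omega> \<and> (\<forall>x\<in>D. \<exists>N. pole_at D N S \<omega> x)}"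

text \<open>For a \<open>(1,1)\<close>-form, \<open>dz/z \<and> \<beta>\<^sub>0\<close> with \<open>\<beta>\<^sub>0 = b d(cnj z)\<close> has coefficient \<open>b / z\<close>.\<close>

definition forms2_log :: "'a surface \<Rightarrow> 'a set \<Rightarrow> 'a form set"
  where "forms2_log S D = {\<alpha> \<in> forms_star 1 1 S D. \<forall>x\<in>D. pole_at D 1 S \<alpha> x}"

text \<open>On \<open>(0,1)\<close>-forms: \<open>\<partial>(b d(cnj z)) = (\<partial>b/\<partial>z) dz \<and> d(cnj z)\<close>.\<close>

definition del_form :: "'a form \<Rightarrow> 'a form"
  where "del_form \<beta> c x = dz_within (in_coord \<beta> c) (snd c ` fst c) (snd c x)"

text \<open>Pull-back of \<open>(p,q)\<close>-forms along a holomorphic map; the result does not depend on the chart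
  chosen around \<open>f x\<close>.\<close>

definition pullback :: "nat \<Rightarrow> nat \<Rightarrow> 'b surface \<Rightarrow> ('a \<Rightarrow> 'b) \<Rightarrow> 'b form \<Rightarrow> 'a form"
  where "pullback p q T f \<omega> c x =
    (let c' = (SOME c'. c' \<in> charts T \<and> f x \<in> fst c');
         d = cderiv_within (local_expr f c c') (local_dom f c c') (snd c x)
     in \<omega> c' (f x) * d ^ p * cnj d ^ q)"


section \<open>Integration and the regularized integral\<close>

definition partition_of_unity ::
    "'a surface \<Rightarrow> nat \<Rightarrow> (nat \<Rightarrow> 'a chart) \<Rightarrow> (nat \<Rightarrow> 'a \<Rightarrow> real) \<Rightarrow> bool"
  where "partition_of_unity S n c \<rho> \<longleftrightarrow>
    (\<forall>j<n. c j \<in> charts S \<and>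
       (\<forall>c'\<in>charts S. smooth_on (\<rho> j \<circ> chart_inv c') (snd c' ` fst c')) \<and>
       (\<forall>x\<in>points S. 0 \<le> \<rho> j x) \<and>
       surf_top S closure_of {x \<in> points S. \<rho> j x \<noteq> 0} \<subseteq> fst (c j)) \<and>
    (\<forall>x\<in>points S. (\<Sum>j<n. \<rho> j x) = 1)"

text \<open>The factor \<open>-2\<i>\<close> comes from \<open>dz \<and> d(cnj z) = -2\<i> dx \<and> dy\<close>.\<close>

definition chart_integral2 :: "'a chart \<Rightarrow> ('a \<Rightarrow> real) \<Rightarrow> 'a form \<Rightarrow> complex"
  where "chart_integral2 c \<rho> \<alpha> =
    set_lebesgue_integral lborel (snd c ` fst c)
      (\<lambda>z. complex_of_real (\<rho> (chart_inv c z)) * in_coord \<alpha> c z * (- 2 * \<i>))"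

text \<open>The boundary orientation induced on the real line by the upper half plane is the direction of
  increasing \<open>x\<close>, and \<open>d(cnj z)\<close> restricts to \<open>dx\<close> there.\<close>

definition chart_integral1 :: "'a chart \<Rightarrow> ('a \<Rightarrow> real) \<Rightarrow> 'a form \<Rightarrow> complex"
  where "chart_integral1 c \<rho> \<beta> =
    set_lebesgue_integral lborel {x. complex_of_real x \<in> snd c ` fst c}
      (\<lambda>x. complex_of_real (\<rho> (chart_inv c (complex_of_real x))) *
           in_coord \<beta> c (complex_of_real x))"

text \<open>For forms with the regularity required in \<open>reg_integral\<close>, the values in the three \<open>THE\<close>
  definitions below do not depend on the partition of unity or on the decomposition, so \<open>THE\<close>
  picks the common value.\<close>

definition surface_integral :: "'a surface \<Rightarrow> 'a form \<Rightarrow> complex"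
  where "surface_integral S \<alpha> =
    (THE v. \<exists>n c \<rho>. partition_of_unity S n c \<rho> \<and> v = (\<Sum>j<n. chart_integral2 (c j) (\<rho> j) \<alpha>))"

definition boundary_integral :: "'a surface \<Rightarrow> 'a form \<Rightarrow> complex"
  where "boundary_integral S \<beta> =
    (THE v. \<exists>n c \<rho>. partition_of_unity S n c \<rho> \<and> v = (\<Sum>j<n. chart_integral1 (c j) (\<rho> j) \<beta>))"

definition decomposes ::
    "'a surface \<Rightarrow> 'a set \<Rightarrow> 'a form \<Rightarrow> 'a form \<Rightarrow> 'a form \<Rightarrow> bool"
  where "decomposes S D \<omega> \<alpha> \<beta> \<longleftrightarrow>
    \<alpha> \<in> forms2_log S D \<and> \<beta> \<in> forms_star 0 1 S D \<and>
    (\<forall>c\<in>charts S. \<forall>x \<in> fst c - D. \<omega> c x = \<alpha> c x + del_form \<beta> c x)"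

definition reg_integral :: "'a surface \<Rightarrow> 'a set \<Rightarrow> 'a form \<Rightarrow> complex"
  where "reg_integral S D \<omega> =
    (THE v. \<exists>\<alpha> \<beta>. decomposes S D \<omega> \<alpha> \<beta> \<and> v = surface_integral S \<alpha> + boundary_integral S \<beta>)"

end

theory Submission
  imports Defs
begin

text \<open>A biholomorphic map identifies the maximal atlases, the forms, the partitions of unity and the
  decompositions \<open>\<omega> = \<alpha> + \<partial>\<beta>\<close> of the two surfaces, and in corresponding charts the coordinate
  expressions literally coincide. Hence the sets of candidate values in the \<open>THE\<close> definitions of
  the integrals are equal, and neither existence nor uniqueness of these values is needed. The only
  friction is that charts carry irrelevant values outside their domain, so that pushing a chart
  forward and back returns it only up to such values.\<close>

section \<open>Locality of smoothness and of derivatives within a set, and basic facts on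
  charts\<close>

lemma smooth_on_cong:
  assumes "\<And>z. z \<in> S \<Longrightarrow> g z = h z"
  shows "smooth_on g S \<longleftrightarrow> smooth_on h S"
  using assms unfolding smooth_on_def by (metis IntE)

text \<open>Both functions have exactly the same derivatives at \<open>z\<close>, so
  \<open>THE\<close> is applied to one and the same predicate.\<close>

lemma cderiv_within_cong:
  assumes "\<And>w. w \<in> S \<Longrightarrow> g w = h w" and "z \<in> S"
  shows "cderiv_within g S z = cderiv_within h S z"
proof -
  have "(g has_field_derivative d) (at z within S) \<longleftrightarrow> (h has_field_derivative d) (at z within S)" for d
    using assms has_derivative_transform[of z S h g "(*) d"] has_derivative_transform[of z S g h "(*) d"]
    by (auto simp: has_field_derivative_def)
  then show ?thesis
    by (simp add: cderiv_within_def)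
qed

lemma dz_within_cong:
  assumes "\<And>w. w \<in> S \<Longrightarrow> g w = h w" and "z \<in> S"
  shows "dz_within g S z = dz_within h S z"
proof -
  have "(g has_derivative d) (at z within S) \<longleftrightarrow> (h has_derivative d) (at z within S)" for d
    using assms has_derivative_transform[of z S h g d] has_derivative_transform[of z S g h d] by auto
  then show ?thesis
    by (simp add: dz_within_def frechet_derivative_def)
qed

lemma chart_inv_eq:
  assumes "inj_on (snd c) (fst c)" "x \<in> fst c"
  shows "chart_inv c (snd c x) = x"
  using assms by (simp add: chart_inv_def)

text \<open>\<open>homeomorphic_map\<close> yields injectivity on the topspace of the subtopology,
  which is all of \<open>fst c\<close> because an open set lies in the topspace.\<close>

lemma is_chart_inj_on: "is_chart X c \<Longrightarrow> inj_on (snd c) (fst c)"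
  unfolding is_chart_def homeomorphic_map_def quotient_map_def
  by (metis inf.absorb_iff2 openin_subset topspace_subtopology)

lemma is_chart_subset: "is_chart X c \<Longrightarrow> fst c \<subseteq> topspace X"
  by (simp add: is_chart_def openin_subset)

lemma is_chart_charts:
  "compact_riemann_surface S \<Longrightarrow> c \<in> charts S \<Longrightarrow> is_chart (surf_top S) c"
  by (simp add: compact_riemann_surface_def)

lemma charts_maximal:
  assumes "compact_riemann_surface S" "is_chart (surf_top S) c"
    and "\<And>c'. c' \<in> charts S \<Longrightarrow> compatible c c'"
  shows "c \<in> charts S"
  using assms unfolding compact_riemann_surface_def by blast

lemma charts_cover:
  assumes "compact_riemann_surface S" "x \<in> points S"
  obtains c where "c \<in> charts S" "x \<in> fst c"
  using assms unfolding compact_riemann_surface_def by blast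


section \<open>Forms with the same coefficients off the polar set\<close>

text \<open>Values on \<open>D\<close> and outside chart domains are arbitrary, so this is the
  meaningful notion of equality of forms. The pull-back is compared with the transported form only
  in this sense.\<close>

definition agree_off :: "'a surface \<Rightarrow> 'a set \<Rightarrow> 'a form \<Rightarrow> 'a form \<Rightarrow> bool"
  where "agree_off S D \<alpha> \<beta> \<longleftrightarrow> (\<forall>c\<in>charts S. \<forall>x\<in>fst c - D. \<alpha> c x = \<beta> c x)"

text \<open>The transformation law, smoothness and the pole condition all test coefficients only at
  points of \<open>fst c - D\<close>.\<close>

lemma forms_star_cong:
  assumes S: "compact_riemann_surface S" and ag: "agree_off S D \<alpha> \<beta>"
    and \<alpha>: "\<alpha> \<in> forms_star p q S D"
  shows "\<beta> \<in> forms_star p q S D"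
proof -
  have eq: "\<alpha> c x = \<beta> c x" if "c \<in> charts S" "x \<in> fst c - D" for c x
    using ag that by (simp add: agree_off_def)
  have "smooth_on (in_coord \<beta> c) (snd c ` (fst c - D))" if c: "c \<in> charts S" for c
  proof -
    note inj = is_chart_inj_on[OF is_chart_charts[OF S c]]
    have "smooth_on (in_coord \<alpha> c) (snd c ` (fst c - D))"
      using \<alpha> c by (simp add: forms_star_def is_form_def)
    then show ?thesis
      by (subst smooth_on_cong[where h = "in_coord \<alpha> c"])
        (auto simp: in_coord_def chart_inv_eq[OF inj] eq[OF c])
  qed
  moreover have "pole_at D N S \<beta> x" if pole: "pole_at D N S \<alpha> x" for N x
  proof -
    obtain c W g where "c \<in> charts S" "x \<in> fst c" "open W" "snd c x \<in> W" "Cinf_on g W"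
      "\<And>y. y \<in> fst c - D \<Longrightarrow> snd c y \<in> W \<Longrightarrow> \<alpha> c y = g (snd c y) / (snd c y - snd c x) ^ N"
      using pole unfolding pole_at_def by blast
    then show ?thesis
      unfolding pole_at_def
      by (intro bexI[of _ c] conjI exI[of _ W] exI[of _ g]) (auto simp: eq[symmetric])
  qed
  moreover have "\<forall>x\<in>D. \<exists>N. pole_at D N S \<alpha> x"
    using \<alpha> by (simp add: forms_star_def)
  ultimately have *: "\<forall>c\<in>charts S. smooth_on (in_coord \<beta> c) (snd c ` (fst c - D))"
    "\<forall>x\<in>D. \<exists>N. pole_at D N S \<beta> x"
    by blast+
  have "\<beta> c x = \<beta> c' x * cderiv_within (transition c c') (overlap c c') (snd c x) ^ p
      * cnj (cderiv_within (transition c c') (overlap c c') (snd c x)) ^ q"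
    if "c \<in> charts S" "c' \<in> charts S" "x \<in> fst c \<inter> fst c' - D" for c c' x
  proof -
    have "\<alpha> c x = \<alpha> c' x * cderiv_within (transition c c') (overlap c c') (snd c x) ^ p
        * cnj (cderiv_within (transition c c') (overlap c c') (snd c x)) ^ q"
      using \<alpha> that unfolding forms_star_def is_form_def Let_def by blast
    then show ?thesis
      using eq[of c x] eq[of c' x] that by simp
  qed
  then show ?thesis
    using * unfolding forms_star_def is_form_def Let_def by blast
qed

lemma decomposes_cong:
  "agree_off S D \<omega> \<omega>' \<Longrightarrow> decomposes S D \<omega> \<alpha> \<beta> \<longleftrightarrow> decomposes S D \<omega>' \<alpha> \<beta>"
  by (auto simp: decomposes_def agree_off_def)

lemma reg_integral_cong:
  "agree_off S D \<omega> \<omega>' \<Longrightarrow> reg_integral S D \<omega> = reg_integral S D \<omega>'"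
  by (simp add: reg_integral_def decomposes_cong)

section \<open>Integrals do not see values on the polar set\<close>

lemma set_lebesgue_integral_finite_difference:
  fixes h k :: "'c::euclidean_space \<Rightarrow> 'd::{banach, second_countable_topology}"
  assumes "finite N" "\<And>x. x \<in> A \<Longrightarrow> x \<notin> N \<Longrightarrow> h x = k x"
  shows "set_lebesgue_integral lborel A h = set_lebesgue_integral lborel A k"
  unfolding set_lebesgue_integral_def
  by (rule integral_discrete_difference[where X = N])
    (use assms in \<open>auto simp: countable_finite indicator_def\<close>)

text \<open>The integrands may differ only at coordinates of points of \<open>D\<close>, and finite
  sets are null both in the plane and on the line.\<close>

lemma chart_integral_cong:
  assumes S: "compact_riemann_surface S" and D: "finite D" and ag: "agree_off S D \<alpha> \<beta>"
    and c: "c \<in> charts S"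
  shows "chart_integral2 c \<rho> \<alpha> = chart_integral2 c \<rho> \<beta>"
    and "chart_integral1 c \<rho> \<alpha> = chart_integral1 c \<rho> \<beta>"
proof -
  note inj = is_chart_inj_on[OF is_chart_charts[OF S c]]
  have eq: "in_coord \<alpha> c z = in_coord \<beta> c z" if "z \<in> snd c ` fst c" "z \<notin> snd c ` D" for z
  proof -
    obtain x where "z = snd c x" "x \<in> fst c - D"
      using \<open>z \<in> snd c ` fst c\<close> \<open>z \<notin> snd c ` D\<close> by blast
    then show ?thesis
      using ag c by (simp add: in_coord_def chart_inv_eq[OF inj] agree_off_def)
  qed
  show "chart_integral2 c \<rho> \<alpha> = chart_integral2 c \<rho> \<beta>"
    unfolding chart_integral2_def
    by (rule set_lebesgue_integral_finite_difference[where N = "snd c ` D"])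
      (use D eq in auto)
  \<comment> \<open>The exceptional set on the line: the reals embed injectively in the plane, so
    the preimage of a finite set is finite.\<close>
  have "finite (complex_of_real -` (snd c ` D))"
    using D by (intro finite_vimageI) (auto simp: inj_on_def)
  then show "chart_integral1 c \<rho> \<alpha> = chart_integral1 c \<rho> \<beta>"
    unfolding chart_integral1_def
    by (rule set_lebesgue_integral_finite_difference) (use eq in auto)
qed

text \<open>The candidates over which \<open>THE\<close> ranges in the integral. Collected in a set,
  they can be compared by two inclusions, and equal sets give equal integrals whatever
  \<open>THE\<close> returns.\<close>

definition surface_values :: "'a surface \<Rightarrow> 'a form \<Rightarrow> complex set"
  where "surface_values S \<alpha> =
    {\<Sum>j<n. chart_integral2 (c j) (\<rho> j) \<alpha> | n c \<rho>. partition_of_unity S n c \<rho>}"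

definition boundary_values :: "'a surface \<Rightarrow> 'a form \<Rightarrow> complex set"
  where "boundary_values S \<beta> =
    {\<Sum>j<n. chart_integral1 (c j) (\<rho> j) \<beta> | n c \<rho>. partition_of_unity S n c \<rho>}"

lemma surface_valuesI:
  "partition_of_unity S n c \<rho> \<Longrightarrow> v = (\<Sum>j<n. chart_integral2 (c j) (\<rho> j) \<alpha>) \<Longrightarrow> v \<in> surface_values S \<alpha>"
  unfolding surface_values_def mem_Collect_eq by (intro exI conjI)

lemma boundary_valuesI:
  "partition_of_unity S n c \<rho> \<Longrightarrow> v = (\<Sum>j<n. chart_integral1 (c j) (\<rho> j) \<beta>) \<Longrightarrow> v \<in> boundary_values S \<beta>"
  unfolding boundary_values_def mem_Collect_eq by (intro exI conjI)

lemma surface_integral_eq: "surface_integral S \<alpha> = (THE v. v \<in> surface_values S \<alpha>)"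
  unfolding surface_integral_def surface_values_def mem_Collect_eq
  by (intro arg_cong[where f = The] ext) blast

lemma boundary_integral_eq: "boundary_integral S \<beta> = (THE v. v \<in> boundary_values S \<beta>)"
  unfolding boundary_integral_def boundary_values_def mem_Collect_eq
  by (intro arg_cong[where f = The] ext) blast

lemma integral_values_cong:
  assumes S: "compact_riemann_surface S" and D: "finite D" and ag: "agree_off S D \<alpha> \<beta>"
  shows "surface_values S \<alpha> = surface_values S \<beta>"
    and "boundary_values S \<alpha> = boundary_values S \<beta>"
proof -
  have sums: "(\<Sum>j<n. chart_integral2 (c j) (\<rho> j) \<alpha>) = (\<Sum>j<n. chart_integral2 (c j) (\<rho> j) \<beta>)"
    "(\<Sum>j<n. chart_integral1 (c j) (\<rho> j) \<alpha>) = (\<Sum>j<n. chart_integral1 (c j) (\<rho> j) \<beta>)"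
    if P: "partition_of_unity S n c \<rho>" for n c \<rho>
  proof -
    have "c j \<in> charts S" if "j < n" for j
      using P that by (simp add: partition_of_unity_def)
    then show "(\<Sum>j<n. chart_integral2 (c j) (\<rho> j) \<alpha>) = (\<Sum>j<n. chart_integral2 (c j) (\<rho> j) \<beta>)"
      "(\<Sum>j<n. chart_integral1 (c j) (\<rho> j) \<alpha>) = (\<Sum>j<n. chart_integral1 (c j) (\<rho> j) \<beta>)"
      by (simp_all add: chart_integral_cong[OF S D ag])
  qed
  then show "surface_values S \<alpha> = surface_values S \<beta>" "boundary_values S \<alpha> = boundary_values S \<beta>"
    unfolding surface_values_def boundary_values_def
    by (intro Collect_cong arg_cong[where f = Ex] ext; auto simp: sums)+
qed

text \<open>The derivative of the transition map from \<open>c\<close> to \<open>c'\<close> is literally that of the transition map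
  from \<open>c'\<close> to itself, so the transformation law for the latter pair already shows that the
  transition factor acts trivially on the coefficient.\<close>

lemma form_equal_charts:
  assumes S: "compact_riemann_surface S" and \<omega>: "is_form p q S D \<omega>"
    and c: "c \<in> charts S" and c': "c' \<in> charts S"
    and fst: "fst c = fst c'" and snd: "\<And>x. x \<in> fst c \<Longrightarrow> snd c x = snd c' x"
    and x: "x \<in> fst c - D"
  shows "\<omega> c x = \<omega> c' x"
proof -
  note inj = is_chart_inj_on[OF is_chart_charts[OF S c]]
  note inj' = is_chart_inj_on[OF is_chart_charts[OF S c']]
  have dom: "overlap c c' = overlap c' c'"
    unfolding overlap_def fst by (intro image_cong) (use fst snd in auto)
  have "transition c c' z = transition c' c' z" if z: "z \<in> overlap c' c'" for z
  proof -
    obtain y where y: "y \<in> fst c'" "z = snd c' y"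
      using z by (auto simp: overlap_def)
    then have "chart_inv c z = y" "chart_inv c' z = y"
      using chart_inv_eq[OF inj, of y] chart_inv_eq[OF inj', of y] fst snd[of y] by simp_all
    then show ?thesis
      by (simp add: transition_def)
  qed
  moreover have "snd c' x \<in> overlap c' c'" "snd c x = snd c' x"
    using x fst snd[of x] by (auto simp: overlap_def)
  ultimately have t: "cderiv_within (transition c c') (overlap c c') (snd c x)
      = cderiv_within (transition c' c') (overlap c' c') (snd c' x)"
    unfolding dom by (metis cderiv_within_cong[of "overlap c' c'" "transition c c'" "transition c' c'"])
  \<comment> \<open>For \<open>d = c\<close> and for \<open>d = c'\<close> the right-hand sides
    coincide by \<open>t\<close>, hence so do the coefficients on the left.\<close>
  have law: "\<omega> d x = \<omega> c' x * cderiv_within (transition d c') (overlap d c') (snd d x) ^ p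
      * cnj (cderiv_within (transition d c') (overlap d c') (snd d x)) ^ q"
    if "d \<in> charts S" "x \<in> fst d" for d
    using \<omega> c' x fst that unfolding is_form_def Let_def by blast
  show ?thesis
    using law[OF c, unfolded t] law[OF c'] x fst by (metis DiffD1)
qed


section \<open>Transport along a biholomorphic map\<close>

text \<open>The inverse \<open>g\<close> is a separate argument, so exchanging \<open>f\<close> and
  \<open>g\<close> gives the push-forward in the other direction.\<close>

definition push_chart :: "('a \<Rightarrow> 'b) \<Rightarrow> ('b \<Rightarrow> 'a) \<Rightarrow> 'a chart \<Rightarrow> 'b chart"
  where "push_chart f g c = (f ` fst c, snd c \<circ> g)"

text \<open>The pull-back along \<open>f\<close> by relabelling: between \<open>c\<close> and its
  pushed chart the coordinate expression of \<open>f\<close> is the identity, so no derivative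
  factor appears.\<close>

definition transport_form :: "('a \<Rightarrow> 'b) \<Rightarrow> ('b \<Rightarrow> 'a) \<Rightarrow> 'b form \<Rightarrow> 'a form"
  where "transport_form f g \<omega> c x = \<omega> (push_chart f g c) (f x)"

text \<open>The assumptions are symmetric in the two surfaces. Each statement proved in one
  direction therefore gives its converse through \<open>swap\<close>.\<close>

locale biholomorphic_pair =
  fixes S1 :: "'a surface" and S2 :: "'b surface" and f :: "'a \<Rightarrow> 'b" and g :: "'b \<Rightarrow> 'a"
  assumes S1: "compact_riemann_surface S1" and S2: "compact_riemann_surface S2"
    and hol_f: "holomorphic_map S1 S2 f" and hol_g: "holomorphic_map S2 S1 g"
    and gf: "\<And>x. x \<in> points S1 \<Longrightarrow> g (f x) = x"
    and fg: "\<And>y. y \<in> points S2 \<Longrightarrow> f (g y) = y"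
begin

section \<open>Pushed charts and their transition maps\<close>

lemma swap: "biholomorphic_pair S2 S1 g f"
  by unfold_locales (use S1 S2 hol_f hol_g gf fg in auto)

lemma homeo: "homeomorphic_maps (surf_top S1) (surf_top S2) f g"
  using hol_f hol_g gf fg by (auto simp: homeomorphic_maps_def holomorphic_map_def)

lemma f_points: "x \<in> points S1 \<Longrightarrow> f x \<in> points S2"
  using homeo by (auto simp: homeomorphic_maps_def continuous_map_def)

lemma chart_points: "c \<in> charts S1 \<Longrightarrow> x \<in> fst c \<Longrightarrow> x \<in> points S1"
  using is_chart_subset[OF is_chart_charts[OF S1]] by blast

lemma chart_inj: "c \<in> charts S1 \<Longrightarrow> inj_on (snd c) (fst c)"
  by (rule is_chart_inj_on[OF is_chart_charts[OF S1]])

lemma chart_gf: "c \<in> charts S1 \<Longrightarrow> x \<in> fst c \<Longrightarrow> g (f x) = x"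
  by (simp add: gf chart_points)

lemma push_image: "c \<in> charts S1 \<Longrightarrow> snd (push_chart f g c) ` fst (push_chart f g c) = snd c ` fst c"
  by (auto simp: push_chart_def chart_gf image_iff)

lemma push_snd: "c \<in> charts S1 \<Longrightarrow> x \<in> fst c \<Longrightarrow> snd (push_chart f g c) (f x) = snd c x"
  by (simp add: push_chart_def chart_gf)

lemma push_inj: "c \<in> charts S1 \<Longrightarrow> inj_on (snd (push_chart f g c)) (fst (push_chart f g c))"
  using chart_inj[of c] by (auto simp: push_chart_def chart_gf intro!: inj_onI dest: inj_onD)

lemma push_chart_inv:
  assumes c: "c \<in> charts S1" and z: "z \<in> snd c ` fst c"
  shows "chart_inv (push_chart f g c) z = f (chart_inv c z)"
proof -
  obtain x where x: "x \<in> fst c" "z = snd c x"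
    using z by blast
  have "f x \<in> fst (push_chart f g c)"
    using x by (simp add: push_chart_def)
  from chart_inv_eq[OF push_inj[OF c] this] show ?thesis
    using x c by (simp add: push_snd chart_inv_eq[OF chart_inj])
qed

text \<open>\<open>f\<close> restricts to a homeomorphism from \<open>fst c\<close> onto its image;
  composing the inverse \<open>g\<close> with the coordinate leaves the image in the half plane
  unchanged.\<close>

lemma push_chart_is_chart:
  assumes c: "c \<in> charts S1"
  shows "is_chart (surf_top S2) (push_chart f g c)"
proof -
  have ic: "is_chart (surf_top S1) c"
    by (rule is_chart_charts[OF S1 c])
  have hf: "homeomorphic_map (surf_top S1) (surf_top S2) f"
    using homeo homeomorphic_map_maps by blast
  have sub: "fst c \<subseteq> points S1"
    by (rule is_chart_subset[OF ic])
  have op: "openin (surf_top S2) (f ` fst c)"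
    using homeomorphic_imp_open_map[OF hf] ic by (auto simp: is_chart_def open_map_def)
  have "homeomorphic_maps (subtopology (surf_top S1) (fst c)) (subtopology (surf_top S2) (f ` fst c)) f g"
    by (rule homeomorphic_maps_subtopologies_alt[OF homeo])
      (use sub chart_gf[OF c] in auto)
  then have "homeomorphic_map (subtopology (surf_top S2) (f ` fst c)) (subtopology (surf_top S1) (fst c)) g"
    using homeomorphic_maps_map homeomorphic_maps_sym by blast
  moreover have "homeomorphic_map (subtopology (surf_top S1) (fst c)) (top_of_set (snd c ` fst c)) (snd c)"
    using ic by (simp add: is_chart_def)
  ultimately have "homeomorphic_map (subtopology (surf_top S2) (f ` fst c)) (top_of_set (snd c ` fst c)) (snd c \<circ> g)"
    by (rule homeomorphic_map_compose)
  then show ?thesis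
    using op ic push_image[OF c] unfolding is_chart_def by (simp add: push_chart_def)
qed

text \<open>The overlaps are the sets on which the local expressions of \<open>f\<close> and
  \<open>g\<close> live, so compatibility can be read off from holomorphy of the two maps.\<close>

lemma overlap_push:
  assumes c: "c \<in> charts S1" and c': "c' \<in> charts S2"
  shows "overlap (push_chart f g c) c' = local_dom f c c'"
    and "overlap c' (push_chart f g c) = local_dom g c' c"
proof -
  have "f ` fst c \<inter> fst c' = f ` (fst c \<inter> f -` fst c')"
    by blast
  then show "overlap (push_chart f g c) c' = local_dom f c c'"
    using chart_gf[OF c] by (simp add: overlap_def local_dom_def push_chart_def image_image)
  have "y \<in> points S2" if "y \<in> fst c'" for y
    using that c' is_chart_subset[OF is_chart_charts[OF S2]] by blast
  then have "fst c' \<inter> f ` fst c = fst c' \<inter> g -` fst c"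
    using chart_gf[OF c] fg by (auto simp: image_iff) (metis)
  then show "overlap c' (push_chart f g c) = local_dom g c' c"
    by (simp add: overlap_def local_dom_def push_chart_def)
qed

lemma transition_push:
  assumes c: "c \<in> charts S1" and z: "z \<in> snd c ` fst c"
  shows "transition (push_chart f g c) c' z = local_expr f c c' z"
  using push_chart_inv[OF c z] by (simp add: transition_def local_expr_def)

text \<open>Maximality of the atlas reduces the claim to compatibility with every chart
  \<open>c'\<close>. The two transition maps are local expressions of \<open>f\<close> and of
  \<open>g\<close>, so holomorphy in both directions is what is used.\<close>

lemma push_chart_charts:
  assumes c: "c \<in> charts S1"
  shows "push_chart f g c \<in> charts S2"
proof (rule charts_maximal[OF S2 push_chart_is_chart[OF c]])
  fix c' assume c': "c' \<in> charts S2"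
  have "local_expr f c c' holomorphic_on local_dom f c c'"
    using hol_f c c' by (simp add: holomorphic_map_def)
  then have "transition (push_chart f g c) c' holomorphic_on local_dom f c c'"
    by (rule holomorphic_transform) (auto simp: local_dom_def transition_push[OF c])
  \<comment> \<open>This equality of functions holds everywhere by definition; the one for the
    opposite direction holds only on the image of \<open>c\<close>.\<close>
  moreover have "transition c' (push_chart f g c) = local_expr g c' c"
    by (auto simp: transition_def local_expr_def push_chart_def)
  moreover have "local_expr g c' c holomorphic_on local_dom g c' c"
    using hol_g c c' by (simp add: holomorphic_map_def)
  ultimately show "compatible (push_chart f g c) c'"
    using overlap_push[OF c c'] by (simp add: compatible_def)
qed

lemma overlap_push_push:
  assumes c: "c \<in> charts S1" and c': "c' \<in> charts S1"
  shows "overlap (push_chart f g c) (push_chart f g c') = overlap c c'"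
proof -
  have "f ` fst c \<inter> f ` fst c' = f ` (fst c \<inter> fst c')"
    using gf chart_points[OF c] chart_points[OF c']
    by (intro inj_on_image_Int[symmetric, of _ "points S1"]) (auto intro: inj_on_inverseI)
  then show ?thesis
    using chart_gf[OF c] by (simp add: overlap_def push_chart_def image_image)
qed

lemma transition_push_push:
  assumes c: "c \<in> charts S1" and c': "c' \<in> charts S1" and z: "z \<in> overlap c c'"
  shows "transition (push_chart f g c) (push_chart f g c') z = transition c c' z"
proof -
  obtain x where x: "x \<in> fst c" "z = snd c x"
    using z by (auto simp: overlap_def)
  then have "chart_inv (push_chart f g c) z = f x" "chart_inv c z = x"
    using push_chart_inv[OF c] chart_inv_eq[OF chart_inj[OF c]] by auto
  then show ?thesis
    using chart_gf[OF c] x by (simp add: transition_def push_chart_def)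
qed

section \<open>Transport of forms, of \<open>\<partial>\<close> and of poles\<close>

lemma in_coord_transport:
  assumes "c \<in> charts S1" "z \<in> snd c ` fst c"
  shows "in_coord (transport_form f g \<omega>) c z = in_coord \<omega> (push_chart f g c) z"
  using push_chart_inv[OF assms] by (simp add: in_coord_def transport_form_def)

text \<open>Both sides differentiate, within the same planar set, functions that coincide on that
  whole set; no chain rule enters.\<close>

lemma del_form_transport:
  assumes c: "c \<in> charts S1" and x: "x \<in> fst c"
  shows "del_form (transport_form f g \<beta>) c x = del_form \<beta> (push_chart f g c) (f x)"
  unfolding del_form_def push_image[OF c] push_snd[OF c x]
  by (rule dz_within_cong) (use x in_coord_transport[OF c] in auto)

lemma f_notin_image:
  assumes "D \<subseteq> points S1" "x \<in> points S1" "x \<notin> D"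
  shows "f x \<notin> f ` D"
  using assms gf by (metis imageE subsetD)

text \<open>Pushing forth and back may change the coordinate outside the chart domain, so it can
  produce a different element of the atlas. By \<open>form_equal_charts\<close> a form has the same
  coefficient in both.\<close>

lemma push_push_form:
  assumes \<omega>: "is_form p q S1 D \<omega>" and c: "c \<in> charts S1" and x: "x \<in> fst c - D"
  shows "\<omega> (push_chart g f (push_chart f g c)) x = \<omega> c x"
proof -
  interpret sw: biholomorphic_pair S2 S1 g f by (rule swap)
  have "push_chart g f (push_chart f g c) \<in> charts S1"
    using c push_chart_charts sw.push_chart_charts by blast
  then show ?thesis
    by (rule form_equal_charts[OF S1 \<omega> _ c])
      (use chart_gf[OF c] x in \<open>auto simp: push_chart_def image_iff\<close>)
qed

lemma transport_transport:
  assumes \<omega>: "is_form p q S1 D \<omega>"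
  shows "agree_off S1 D (transport_form f g (transport_form g f \<omega>)) \<omega>"
  unfolding agree_off_def transport_form_def
  using push_push_form[OF \<omega>] chart_gf by auto

text \<open>The law for \<omega> at \<open>f x\<close> in the pushed charts is the required law at
  \<open>x\<close>, because overlaps, transition maps and hence derivative factors are the
  same.\<close>

lemma transport_is_form:
  assumes D: "D \<subseteq> points S1" and \<omega>: "is_form p q S2 (f ` D) \<omega>"
  shows "is_form p q S1 D (transport_form f g \<omega>)"
  unfolding is_form_def Let_def
proof (intro conjI ballI)
  fix c c' x
  assume c: "c \<in> charts S1" and c': "c' \<in> charts S1" and x: "x \<in> fst c \<inter> fst c' - D"
  let ?c = "push_chart f g c" and ?c' = "push_chart f g c'"
  have "f x \<in> fst ?c \<inter> fst ?c' - f ` D"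
    using x f_notin_image[OF D chart_points[OF c]] by (auto simp: push_chart_def)
  then have "\<omega> ?c (f x) = \<omega> ?c' (f x)
      * cderiv_within (transition ?c ?c') (overlap ?c ?c') (snd ?c (f x)) ^ p
      * cnj (cderiv_within (transition ?c ?c') (overlap ?c ?c') (snd ?c (f x))) ^ q"
    using \<omega> push_chart_charts[OF c] push_chart_charts[OF c'] unfolding is_form_def Let_def by blast
  moreover have "cderiv_within (transition ?c ?c') (overlap ?c ?c') (snd ?c (f x))
      = cderiv_within (transition c c') (overlap c c') (snd c x)"
    unfolding overlap_push_push[OF c c']
    using x push_snd[OF c, of x]
    by (auto intro!: cderiv_within_cong transition_push_push[OF c c'] simp: overlap_def)
  ultimately show "transport_form f g \<omega> c x = transport_form f g \<omega> c' x
      * cderiv_within (transition c c') (overlap c c') (snd c x) ^ p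
      * cnj (cderiv_within (transition c c') (overlap c c') (snd c x)) ^ q"
    by (simp add: transport_form_def)
next
  fix c assume c: "c \<in> charts S1"
  let ?c = "push_chart f g c"
  have "fst ?c - f ` D = f ` (fst c - D)"
    using f_notin_image[OF D chart_points[OF c]] by (auto simp: push_chart_def)
  then have "snd ?c ` (fst ?c - f ` D) = snd c ` (fst c - D)"
    using push_snd[OF c] by (simp add: image_image)
  then have "smooth_on (in_coord \<omega> ?c) (snd c ` (fst c - D))"
    using \<omega> push_chart_charts[OF c] unfolding is_form_def by metis
  then show "smooth_on (in_coord (transport_form f g \<omega>) c) (snd c ` (fst c - D))"
    by (subst smooth_on_cong[where h = "in_coord \<omega> ?c"]) (auto simp: in_coord_transport[OF c])
qed

text \<open>The chart witnessing the pole at \<open>f x\<close> is moved back to the first surface;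
  the neighbourhood \<open>W\<close>, the numerator \<open>h\<close> and the order \<open>N\<close>
  are kept. In particular logarithmic poles stay logarithmic.\<close>

lemma transport_pole_at:
  assumes D: "D \<subseteq> points S1" and \<omega>: "is_form p q S2 (f ` D) \<omega>"
    and x: "x \<in> D" and pole: "pole_at (f ` D) N S2 \<omega> (f x)"
  shows "pole_at D N S1 (transport_form f g \<omega>) x"
proof -
  interpret sw: biholomorphic_pair S2 S1 g f by (rule swap)
  obtain c W h where c: "c \<in> charts S2" and xc: "f x \<in> fst c"
    and W: "open W" "snd c (f x) \<in> W" "Cinf_on h W"
    and eq: "\<And>y. y \<in> fst c - f ` D \<Longrightarrow> snd c y \<in> W \<Longrightarrow> \<omega> c y = h (snd c y) / (snd c y - snd c (f x)) ^ N"
    using pole unfolding pole_at_def by blast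
  let ?c = "push_chart g f c"
  have snd: "snd ?c y = snd c (f y)" for y
    by (simp add: push_chart_def)
  have "?c \<in> charts S1"
    by (rule sw.push_chart_charts[OF c])
  moreover have "x \<in> fst ?c"
    using xc gf x D unfolding push_chart_def by (metis fst_conv image_eqI subsetD)
  \<comment> \<open>The left-hand side evaluates \<omega> in the chart \<open>c\<close> pushed back
    and forth, not in \<open>c\<close> itself; \<open>sw.push_push_form\<close> bridges the
    difference off the polar set.\<close>
  moreover have "transport_form f g \<omega> ?c y = h (snd ?c y) / (snd ?c y - snd ?c x) ^ N"
    if y: "y \<in> fst ?c - D" "snd ?c y \<in> W" for y
  proof -
    have "f y \<in> fst c"
      using y sw.chart_gf[OF c] by (auto simp: push_chart_def)
    moreover have "f y \<notin> f ` D"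
      using y f_notin_image[OF D] chart_points[OF \<open>?c \<in> charts S1\<close>] by blast
    ultimately show ?thesis
      using sw.push_push_form[OF \<omega> c, of "f y"] eq[of "f y"] y(2) by (simp add: transport_form_def snd)
  qed
  moreover have "snd ?c x \<in> W"
    using W(2) by (simp add: snd)
  ultimately show ?thesis
    unfolding pole_at_def using W(1,3)
    by (intro bexI[of _ ?c] conjI exI[of _ W] exI[of _ h]) auto
qed

lemma transport_forms_star:
  assumes D: "D \<subseteq> points S1" and \<omega>: "\<omega> \<in> forms_star p q S2 (f ` D)"
  shows "transport_form f g \<omega> \<in> forms_star p q S1 D"
proof -
  have form: "is_form p q S2 (f ` D) \<omega>"
    using \<omega> by (simp add: forms_star_def)
  have "\<exists>N. pole_at D N S1 (transport_form f g \<omega>) x" if "x \<in> D" for x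
  proof -
    obtain N where "pole_at (f ` D) N S2 \<omega> (f x)"
      using \<omega> \<open>x \<in> D\<close> by (auto simp: forms_star_def)
    from transport_pole_at[OF D form \<open>x \<in> D\<close> this] show ?thesis ..
  qed
  then show ?thesis
    using transport_is_form[OF D form] by (simp add: forms_star_def)
qed

lemma transport_forms2_log:
  assumes D: "D \<subseteq> points S1" and \<alpha>: "\<alpha> \<in> forms2_log S2 (f ` D)"
  shows "transport_form f g \<alpha> \<in> forms2_log S1 D"
proof -
  have star: "\<alpha> \<in> forms_star 1 1 S2 (f ` D)"
    using \<alpha> by (simp add: forms2_log_def)
  then have form: "is_form 1 1 S2 (f ` D) \<alpha>"
    by (simp add: forms_star_def)
  have "pole_at D 1 S1 (transport_form f g \<alpha>) x" if "x \<in> D" for x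
    by (rule transport_pole_at[OF D form \<open>x \<in> D\<close>]) (use \<alpha> \<open>x \<in> D\<close> in \<open>simp add: forms2_log_def\<close>)
  then show ?thesis
    using transport_forms_star[OF D star] by (simp add: forms2_log_def)
qed

lemma transport_decomposes:
  assumes D: "D \<subseteq> points S1" and dec: "decomposes S2 (f ` D) \<omega> \<alpha> \<beta>"
  shows "decomposes S1 D (transport_form f g \<omega>) (transport_form f g \<alpha>) (transport_form f g \<beta>)"
proof -
  have "transport_form f g \<omega> c x = transport_form f g \<alpha> c x + del_form (transport_form f g \<beta>) c x"
    if c: "c \<in> charts S1" and x: "x \<in> fst c - D" for c x
  proof -
    have "f x \<in> fst (push_chart f g c) - f ` D"
      using x f_notin_image[OF D chart_points[OF c]] by (auto simp: push_chart_def)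
    then show ?thesis
      using dec push_chart_charts[OF c] x del_form_transport[OF c]
      unfolding decomposes_def transport_form_def by auto
  qed
  then show ?thesis
    using dec D transport_forms2_log transport_forms_star unfolding decomposes_def by blast
qed

section \<open>Transport of partitions of unity and of integrals\<close>

lemma push_partition_of_unity:
  assumes P: "partition_of_unity S1 n c \<rho>"
  shows "partition_of_unity S2 n (\<lambda>j. push_chart f g (c j)) (\<lambda>j. \<rho> j \<circ> g)"
proof -
  interpret sw: biholomorphic_pair S2 S1 g f by (rule swap)
  have hf: "homeomorphic_map (surf_top S1) (surf_top S2) f"
    using homeo homeomorphic_map_maps by blast
  have smooth: "smooth_on (\<rho> j \<circ> g \<circ> chart_inv c') (snd c' ` fst c')"
    if j: "j < n" and c': "c' \<in> charts S2" for j c'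
  proof -
    \<comment> \<open>Smoothness in \<open>c'\<close> is smoothness on the first surface in the
      chart moved back, over the same planar set.\<close>
    have "smooth_on (\<rho> j \<circ> chart_inv (push_chart g f c')) (snd c' ` fst c')"
      using P j sw.push_chart_charts[OF c'] sw.push_image[OF c'] unfolding partition_of_unity_def by metis
    then show ?thesis
      by (subst smooth_on_cong[where h = "\<rho> j \<circ> chart_inv (push_chart g f c')"])
        (auto simp: sw.push_chart_inv[OF c'])
  qed
  have supp: "surf_top S2 closure_of {y \<in> points S2. (\<rho> j \<circ> g) y \<noteq> 0} \<subseteq> fst (push_chart f g (c j))"
    if j: "j < n" for j
  proof -
    \<comment> \<open>The new support is the image of the old one, since a homeomorphism commutes
      with closures.\<close>
    have "{y \<in> points S2. (\<rho> j \<circ> g) y \<noteq> 0} = f ` {x \<in> points S1. \<rho> j x \<noteq> 0}"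
      using gf fg f_points sw.f_points by (auto simp: image_iff) (metis)
    then have "surf_top S2 closure_of {y \<in> points S2. (\<rho> j \<circ> g) y \<noteq> 0}
        = f ` (surf_top S1 closure_of {x \<in> points S1. \<rho> j x \<noteq> 0})"
      using homeomorphic_map_closure_of[OF hf, of "{x \<in> points S1. \<rho> j x \<noteq> 0}"] by auto
    moreover have "surf_top S1 closure_of {x \<in> points S1. \<rho> j x \<noteq> 0} \<subseteq> fst (c j)"
      using P j by (simp add: partition_of_unity_def)
    ultimately show ?thesis
      by (auto simp: push_chart_def)
  qed
  show ?thesis
    using P push_chart_charts smooth supp sw.f_points unfolding partition_of_unity_def by simp
qed

text \<open>No change of variables is involved: the domains of integration are equal and the
  integrands coincide on them.\<close>

lemma chart_integral_push:
  assumes c: "c \<in> charts S1"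
  shows "chart_integral2 (push_chart f g c) (\<rho> \<circ> g) \<alpha> = chart_integral2 c \<rho> (transport_form f g \<alpha>)"
    and "chart_integral1 (push_chart f g c) (\<rho> \<circ> g) \<alpha> = chart_integral1 c \<rho> (transport_form f g \<alpha>)"
proof -
  have "g (chart_inv (push_chart f g c) z) = chart_inv c z" if "z \<in> snd c ` fst c" for z
    using that push_chart_inv[OF c] chart_inv_eq[OF chart_inj[OF c]] chart_gf[OF c] by auto
  then have eq: "(\<rho> \<circ> g) (chart_inv (push_chart f g c) z) = \<rho> (chart_inv c z)"
    "in_coord \<alpha> (push_chart f g c) z = in_coord (transport_form f g \<alpha>) c z"
    if "z \<in> snd c ` fst c" for z
    using that in_coord_transport[OF c] by auto
  show "chart_integral2 (push_chart f g c) (\<rho> \<circ> g) \<alpha> = chart_integral2 c \<rho> (transport_form f g \<alpha>)"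
    unfolding chart_integral2_def push_image[OF c]
    \<comment> \<open>With an empty exceptional set the rule is a plain congruence rule for set
      integrals.\<close>
    by (rule set_lebesgue_integral_finite_difference[where N = "{}"]) (use eq in auto)
  show "chart_integral1 (push_chart f g c) (\<rho> \<circ> g) \<alpha> = chart_integral1 c \<rho> (transport_form f g \<alpha>)"
    unfolding chart_integral1_def push_image[OF c]
    by (rule set_lebesgue_integral_finite_difference[where N = "{}"]) (use eq in auto)
qed

text \<open>A partition of unity on the first surface, pushed forward, produces the same sum on the
  second. The reverse inclusions come from \<open>swap\<close>.\<close>

lemma integral_values_transport:
  shows "surface_values S1 (transport_form f g \<alpha>) \<subseteq> surface_values S2 \<alpha>"
    and "boundary_values S1 (transport_form f g \<alpha>) \<subseteq> boundary_values S2 \<alpha>"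
proof -
  have "(\<Sum>j<n. chart_integral2 (c j) (\<rho> j) (transport_form f g \<alpha>)) \<in> surface_values S2 \<alpha> \<and>
      (\<Sum>j<n. chart_integral1 (c j) (\<rho> j) (transport_form f g \<alpha>)) \<in> boundary_values S2 \<alpha>"
    if P: "partition_of_unity S1 n c \<rho>" for n c \<rho>
  proof -
    have "c j \<in> charts S1" if "j < n" for j
      using P that by (simp add: partition_of_unity_def)
    then have
      "(\<Sum>j<n. chart_integral2 (c j) (\<rho> j) (transport_form f g \<alpha>))
        = (\<Sum>j<n. chart_integral2 (push_chart f g (c j)) (\<rho> j \<circ> g) \<alpha>)"
      "(\<Sum>j<n. chart_integral1 (c j) (\<rho> j) (transport_form f g \<alpha>))
        = (\<Sum>j<n. chart_integral1 (push_chart f g (c j)) (\<rho> j \<circ> g) \<alpha>)"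
      by (simp_all add: chart_integral_push)
    then show ?thesis
      by (intro conjI surface_valuesI[OF push_partition_of_unity[OF P]]
          boundary_valuesI[OF push_partition_of_unity[OF P]])
  qed
  then show "surface_values S1 (transport_form f g \<alpha>) \<subseteq> surface_values S2 \<alpha>"
    and "boundary_values S1 (transport_form f g \<alpha>) \<subseteq> boundary_values S2 \<alpha>"
    unfolding surface_values_def[of S1] boundary_values_def[of S1] by auto
qed

lemma transport_integral:
  assumes D: "finite D" and \<alpha>: "is_form p q S2 D \<alpha>"
  shows "surface_integral S1 (transport_form f g \<alpha>) = surface_integral S2 \<alpha>"
    and "boundary_integral S1 (transport_form f g \<alpha>) = boundary_integral S2 \<alpha>"
proof -
  interpret sw: biholomorphic_pair S2 S1 g f by (rule swap)
  let ?\<beta> = "transport_form f g \<alpha>"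
  \<comment> \<open>The swapped inclusion starts from the twice transported form. That form agrees
    with \<alpha> only off the finite set \<open>D\<close>, which suffices for equal candidate
    values.\<close>
  note same = integral_values_cong[OF S2 D sw.transport_transport[OF \<alpha>]]
  have "surface_values S1 ?\<beta> = surface_values S2 \<alpha>"
    using integral_values_transport(1)[of \<alpha>] sw.integral_values_transport(1)[of ?\<beta>]
    unfolding same(1) by (rule subset_antisym)
  then show "surface_integral S1 ?\<beta> = surface_integral S2 \<alpha>"
    by (simp add: surface_integral_eq)
  have "boundary_values S1 ?\<beta> = boundary_values S2 \<alpha>"
    using integral_values_transport(2)[of \<alpha>] sw.integral_values_transport(2)[of ?\<beta>]
    unfolding same(2) by (rule subset_antisym)
  then show "boundary_integral S1 ?\<beta> = boundary_integral S2 \<alpha>"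
    by (simp add: boundary_integral_eq)
qed

section \<open>The regularized integral and the comparison with the pull-back\<close>

lemma decomposes_integral_transport:
  assumes D: "finite D" "D \<subseteq> points S1" and dec: "decomposes S2 (f ` D) \<omega> \<alpha> \<beta>"
  shows "\<exists>\<alpha>' \<beta>'. decomposes S1 D (transport_form f g \<omega>) \<alpha>' \<beta>' \<and>
    surface_integral S2 \<alpha> + boundary_integral S2 \<beta> = surface_integral S1 \<alpha>' + boundary_integral S1 \<beta>'"
proof -
  have \<alpha>: "is_form 1 1 S2 (f ` D) \<alpha>" and \<beta>: "is_form 0 1 S2 (f ` D) \<beta>"
    using dec by (auto simp: decomposes_def forms2_log_def forms_star_def)
  have "finite (f ` D)"
    using D(1) by simp
  note transport_integral(1)[OF this \<alpha>] transport_integral(2)[OF this \<beta>]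
  \<comment> \<open>The witnesses are the transported \<alpha> and \<beta>. The existential form
    lets the swapped instance serve as the converse in the next lemma.\<close>
  then show ?thesis
    using transport_decomposes[OF D(2) dec] by metis
qed

lemma transport_reg_integral:
  assumes D: "finite D" "D \<subseteq> points S1" and \<omega>: "is_form p q S2 (f ` D) \<omega>"
  shows "reg_integral S1 D (transport_form f g \<omega>) = reg_integral S2 (f ` D) \<omega>"
proof -
  interpret sw: biholomorphic_pair S2 S1 g f by (rule swap)
  let ?\<eta> = "transport_form f g \<omega>"
  have D2: "finite (f ` D)" "f ` D \<subseteq> points S2"
    using D f_points by auto
  have gD: "g ` f ` D = D"
    using D gf by (force simp: image_image)
  \<comment> \<open>The swapped lemma speaks of the twice transported \<omega> and of
    \<open>g\<close> f \<open>D\<close>. Decompositions test \<omega> only off the polar set, so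
    they are those of \<omega> itself.\<close>
  have dec2: "decomposes S2 (f ` D) (transport_form g f ?\<eta>) = decomposes S2 (f ` D) \<omega>"
    by (intro ext decomposes_cong[OF sw.transport_transport[OF \<omega>]])
  have "(\<exists>\<alpha> \<beta>. decomposes S1 D ?\<eta> \<alpha> \<beta> \<and> v = surface_integral S1 \<alpha> + boundary_integral S1 \<beta>) \<longleftrightarrow>
      (\<exists>\<alpha> \<beta>. decomposes S2 (f ` D) \<omega> \<alpha> \<beta> \<and> v = surface_integral S2 \<alpha> + boundary_integral S2 \<beta>)" for v
    using decomposes_integral_transport[OF D, of \<omega>]
      sw.decomposes_integral_transport[OF D2, of ?\<eta>, unfolded gD dec2] by metis
  then show ?thesis
    by (simp add: reg_integral_def)
qed

text \<open>The transition map from the pushed chart to a chart \<open>c'\<close> around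
  \<open>f x\<close> is the local expression of \<open>f\<close>. The transformation law of \<omega>
  between these charts thus produces exactly the derivative factor in
  \<open>pullback\<close>.\<close>

lemma transport_agrees_pullback:
  assumes D: "D \<subseteq> points S1" and \<omega>: "is_form p q S2 (f ` D) \<omega>"
  shows "agree_off S1 D (transport_form f g \<omega>) (pullback p q S2 f \<omega>)"
  unfolding agree_off_def
proof (intro ballI)
  fix c x assume c: "c \<in> charts S1" and x: "x \<in> fst c - D"
  \<comment> \<open>The very chart selected in \<open>pullback\<close>, named so that the definition
    can be folded at the end.\<close>
  define c' where "c' = (SOME c'. c' \<in> charts S2 \<and> f x \<in> fst c')"
  have "f x \<in> points S2"
    using x chart_points[OF c] f_points by blast
  then have "\<exists>c'. c' \<in> charts S2 \<and> f x \<in> fst c'"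
    by (metis charts_cover[OF S2])
  then have c': "c' \<in> charts S2" "f x \<in> fst c'"
    unfolding c'_def by (metis (mono_tags, lifting) someI_ex)+
  let ?c = "push_chart f g c"
  have "f x \<in> fst ?c \<inter> fst c' - f ` D"
    using x c' f_notin_image[OF D chart_points[OF c]] by (auto simp: push_chart_def)
  then have "\<omega> ?c (f x) = \<omega> c' (f x)
      * cderiv_within (transition ?c c') (overlap ?c c') (snd ?c (f x)) ^ p
      * cnj (cderiv_within (transition ?c c') (overlap ?c c') (snd ?c (f x))) ^ q"
    using \<omega> push_chart_charts[OF c] c'(1) unfolding is_form_def Let_def by blast
  moreover have "cderiv_within (transition ?c c') (overlap ?c c') (snd ?c (f x))
      = cderiv_within (local_expr f c c') (local_dom f c c') (snd c x)"
    using x c' push_snd[OF c, of x] unfolding overlap_push(1)[OF c c'(1)]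
    by (auto intro!: cderiv_within_cong transition_push[OF c] simp: local_dom_def)
  ultimately show "transport_form f g \<omega> c x = pullback p q S2 f \<omega> c x"
    by (simp add: transport_form_def pullback_def Let_def flip: c'_def)
qed

end

theorem proposition2p8:
  fixes S1 :: "'a surface" and S2 :: "'b surface"
    and f :: "'a \<Rightarrow> 'b" and D1 :: "'a set" and D2 :: "'b set" and \<omega> :: "'b form"
  assumes "compact_riemann_surface S1" and "compact_riemann_surface S2"
    and "diffeomorphism S1 S2 f" and "biholomorphic S1 S2 f"
    and "f ` boundary S1 \<subseteq> boundary S2"
    and "finite D1" and "D1 \<subseteq> points S1" and "D1 \<inter> boundary S1 = {}"
    and "D2 = f ` D1"
    and "\<omega> \<in> forms_star 1 1 S2 D2"
  shows "pullback 1 1 S2 f \<omega> \<in> forms_star 1 1 S1 D1 \<and>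
         reg_integral S1 D1 (pullback 1 1 S2 f \<omega>) = reg_integral S2 D2 \<omega>"
proof -
  let ?g = "inv_into (points S1) f"
  have bij: "bij_betw f (points S1) (points S2)"
    using assms(4) by (simp add: biholomorphic_def)
  interpret biholomorphic_pair S1 S2 f ?g
    using assms(1,2,4) bij_betw_inv_into_left[OF bij] bij_betw_inv_into_right[OF bij]
    by unfold_locales (auto simp: biholomorphic_def)
  have \<omega>: "\<omega> \<in> forms_star 1 1 S2 (f ` D1)" and \<omega>': "is_form 1 1 S2 (f ` D1) \<omega>"
    using assms(9,10) by (auto simp: forms_star_def)
  note ag = transport_agrees_pullback[OF assms(7) \<omega>']
  show ?thesis
    \<comment> \<open>Both claims hold for the transported form and pass to the pull-back, which
      agrees with it off \<open>D1\<close>.\<close>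
    using forms_star_cong[OF S1 ag transport_forms_star[OF assms(7) \<omega>]]
      reg_integral_cong[OF ag] transport_reg_integral[OF assms(6,7) \<omega>'] assms(9)
    by simp
qed

end
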